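(* Assume objective regularity, i.e. $\nabla f,\nabla g$ are jointly Lipschitz in $(x,y)$ with constants $\ell_{f,1},\ell_{g,1}$; for every $x$, $g(x,\cdot)$ is $\rho_g$-strongly convex for some $\rho_g>0$; $f,g\in C^2$ with $\nabla^2f,\nabla^2g$ jointly Lipschitz in $(x,y)$ with constants $\ell_{f,2},\ell_{g,2}$; and for all $(x,y)$, $\|\nabla_xf(x,y)\|_2\le\ell_{f,0}$, $\|\nabla_yf(x,y)\|_2\le\ell_{f,0}$ and $\|\nabla_xg(x,y)\|_2\le\ell_{g,0}$. Let $\mu>0$. Then, for every $x\in\mathbb R^{d_x}$: (i) the barrierized lower problem $\min_{y\in\operatorname{int}(Y)}\psi_\mu(x,y)$ has a unique minimizer $y_\mu^\star(x)\in\operatorname{int}(Y)$; (ii) the map $x\mapsto y_\mu^\star(x)$ is differentiable; (iii) the barrier-smoothed outer objective $F_\mu(x)=f(x,y_\mu^\star(x))$ is differentiable, with $$\nabla F_\mu(x)=\nabla_x f(x,y_\mu^\star(x))-\nabla_{xy}^2\psi_\mu(x,y_\mu^\star(x))^\top\bigl(\nabla_{yy}^2\psi_\mu(x,y_\mu^\star(x))\bigr)^{-1}\nabla_y f(x,y_\mu^\star(x));$$ (iv) there exist finite constants $C_g,C_y,C_F>0$, not depending on $\mu$, such that $$0\le g(x,y_\mu^\star(x))-g(x,y^\star(x))\le C_g\mu,\qquad \|y_\mu^\star(x)-y^\star(x)\|_2\le C_y\sqrt\mu,\qquad |F_\mu(x)-F(x)|\le C_F\sqrt\mu .$$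
   Context: Let $Y=\{y\in\mathbb R^{d_y}:Ay\le b\}$ be a fixed polytope, where $a_i^\top$ ($i=1,\dots,m$) are the rows of $A$; $Y$ is compact, full-dimensional, with nonempty interior. Let $f,g:\mathbb R^{d_x}\times\mathbb R^{d_y}\to\mathbb R$. The original constrained lower solution is $y^\star(x)=\arg\min_{y\in Y}g(x,y)$ (unique by (A2) below) and the original outer objective is $F(x)=f(x,y^\star(x))$, with $\inf_xF(x)>-\infty$. Objective regularity assumption: (A1) $\nabla f,\nabla g$ are jointly Lipschitz in $(x,y)$ with constants $\ell_{f,1},\ell_{g,1}$; (A2) for every $x$, $y\mapsto g(x,y)$ is $\rho_g$-strongly convex for some $\rho_g>0$; (A3) $f,g\in C^2$ and $\nabla^2f,\nabla^2g$ are jointly Lipschitz in $(x,y)$ with constants $\ell_{f,2},\ell_{g,2}$; (A4) for all $(x,y)$, $\|\nabla_xf(x,y)\|_2\le\ell_{f,0}$, $\|\nabla_yf(x,y)\|_2\le\ell_{f,0}$, $\|\nabla_xg(x,y)\|_2\le\ell_{g,0}$. Logarithmic barrier: $\phi(y)=-\sum_{i=1}^m\log(b_i-a_i^\top y)$ on $\operatorname{int}(Y)$; $\psi_\mu(x,y)=g(x,y)+\mu\phi(y)$ for $y\in\operatorname{int}(Y)$. The mixed Hessian $\nabla^2_{xy}h(x,y)\in\mathbb R^{d_y\times d_x}$ denotes the derivative with respect to $x$ of $\nabla_yh(x,y)$. *)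

theory Defs
  imports "HOL-Analysis.Analysis"
begin

definition gradient :: "('a::euclidean_space \<Rightarrow> real) \<Rightarrow> 'a \<Rightarrow> 'a" where
  "gradient h z = (THE D. GDERIV h z :> D)"

(* The Hessian is a bounded linear operator, so that norm and dist on Hessians
   refer to the operator (spectral) norm. This also covers functions on a product
   space, where there is no matrix type at hand. *)
definition hessian :: "('a::euclidean_space \<Rightarrow> real) \<Rightarrow> 'a \<Rightarrow> 'a \<Rightarrow>\<^sub>L 'a" where
  "hessian h z = Blinfun (frechet_derivative (gradient h) (at z))"

definition twice_continuously_differentiable :: "('a::euclidean_space \<Rightarrow> real) \<Rightarrow> bool" where
  "twice_continuously_differentiable h \<longleftrightarrow>
     (\<forall>z. h differentiable (at z)) \<and>
     (\<forall>z. gradient h differentiable (at z)) \<and>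
     continuous_on UNIV (hessian h)"

definition strongly_convex :: "real \<Rightarrow> ('a::real_inner \<Rightarrow> real) \<Rightarrow> bool" where
  "strongly_convex \<rho> h \<longleftrightarrow>
     (\<forall>u v. \<forall>t\<in>{0..1}. h ((1 - t) *\<^sub>R u + t *\<^sub>R v)
        \<le> (1 - t) * h u + t * h v - \<rho> / 2 * t * (1 - t) * (norm (u - v))\<^sup>2)"

definition grad_x :: "('a::euclidean_space \<Rightarrow> 'b::euclidean_space \<Rightarrow> real) \<Rightarrow> 'a \<Rightarrow> 'b \<Rightarrow> 'a" where
  "grad_x h x y = gradient (\<lambda>x'. h x' y) x"

definition grad_y :: "('a::euclidean_space \<Rightarrow> 'b::euclidean_space \<Rightarrow> real) \<Rightarrow> 'a \<Rightarrow> 'b \<Rightarrow> 'b" where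
  "grad_y h x y = gradient (\<lambda>y'. h x y') y"

(* The matrix of the derivative with respect to x of the y-gradient: its rows are
   indexed by the coordinates of y and its columns by those of x. *)
definition hess_xy :: "(real^'n \<Rightarrow> real^'k \<Rightarrow> real) \<Rightarrow> real^'n \<Rightarrow> real^'k \<Rightarrow> real^'n^'k" where
  "hess_xy h x y = jacobian (\<lambda>x'. grad_y h x' y) (at x)"

definition hess_yy :: "(real^'n \<Rightarrow> real^'k \<Rightarrow> real) \<Rightarrow> real^'n \<Rightarrow> real^'k \<Rightarrow> real^'k^'k" where
  "hess_yy h x y = jacobian (\<lambda>y'. grad_y h x y') (at y)"

definition feasible_set :: "real^'k^'m \<Rightarrow> real^'m \<Rightarrow> (real^'k) set" where
  "feasible_set A b = {y. \<forall>i. (A *v y) $ i \<le> b $ i}"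

(* Only the values on the interior of the feasible set matter. There every nonzero row
   of A has positive slack; a zero row contributes the constant - ln (b $ i), which is
   0 if b $ i = 0 since ln 0 = 0. *)
definition log_barrier :: "real^'k^'m \<Rightarrow> real^'m \<Rightarrow> real^'k \<Rightarrow> real" where
  "log_barrier A b y = - (\<Sum>i\<in>UNIV. ln (b $ i - (A *v y) $ i))"

definition barrier_objective ::
  "real^'k^'m \<Rightarrow> real^'m \<Rightarrow> (real^'n \<Rightarrow> real^'k \<Rightarrow> real) \<Rightarrow> real \<Rightarrow> real^'n \<Rightarrow> real^'k \<Rightarrow> real" where
  "barrier_objective A b g \<mu> x y = g x y + \<mu> * log_barrier A b y"

definition lower_solution ::
  "real^'k^'m \<Rightarrow> real^'m \<Rightarrow> (real^'n \<Rightarrow> real^'k \<Rightarrow> real) \<Rightarrow> real^'n \<Rightarrow> real^'k" where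
  "lower_solution A b g x = arg_min_on (g x) (feasible_set A b)"

definition barrier_solution ::
  "real^'k^'m \<Rightarrow> real^'m \<Rightarrow> (real^'n \<Rightarrow> real^'k \<Rightarrow> real) \<Rightarrow> real \<Rightarrow> real^'n \<Rightarrow> real^'k" where
  "barrier_solution A b g \<mu> x =
     arg_min_on (barrier_objective A b g \<mu> x) (interior (feasible_set A b))"

definition outer_objective ::
  "real^'k^'m \<Rightarrow> real^'m \<Rightarrow> (real^'n \<Rightarrow> real^'k \<Rightarrow> real) \<Rightarrow> (real^'n \<Rightarrow> real^'k \<Rightarrow> real)
    \<Rightarrow> real^'n \<Rightarrow> real" where
  "outer_objective A b f g x = f x (lower_solution A b g x)"

definition barrier_outer_objective ::
  "real^'k^'m \<Rightarrow> real^'m \<Rightarrow> (real^'n \<Rightarrow> real^'k \<Rightarrow> real) \<Rightarrow> (real^'n \<Rightarrow> real^'k \<Rightarrow> real)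
    \<Rightarrow> real \<Rightarrow> real^'n \<Rightarrow> real" where
  "barrier_outer_objective A b f g \<mu> x = f x (barrier_solution A b g \<mu> x)"

end

theory Submission
  imports Defs
begin

text \<open>
  The barrier objective \<open>\<psi>\<close> is the strongly convex function \<open>g x\<close> plus \<open>\<mu>\<close> times a convex
  barrier, so on the interior of \<open>Y\<close> its \<open>y\<close>-gradient is strongly monotone with constant \<open>\<rho>\<close>.
  A minimizer exists because the barrier blows up at the boundary of the compact polytope
  (\<open>barrier_attains_minimum\<close>), and the \<open>y\<close>-gradient vanishes at it.

  Strong monotonicity makes the minimizer unique. It also makes the solution map Lipschitz in
  \<open>x\<close>, because the barrier does not depend on \<open>x\<close> (\<open>barrier_solution_lipschitz\<close>), and makes the
  \<open>yy\<close>-Hessian coercive, hence invertible. With a Lipschitz solution curve known in advance, the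
  full implicit function theorem can be bypassed: linearizing the stationarity equation at one
  point and solving for the increment gives the derivative of the solution map
  (\<open>lipschitz_implicit_solution_has_derivative\<close>). The hypergradient formula is then the chain
  rule, where the symmetry of the Hessian turns the adjoint of its inverse into the inverse itself
  (\<open>derivative_of_gradient_symmetric\<close>).

  For the error bounds, stationarity says \<open>\<nabla>\<^sub>y g = - \<mu> \<nabla>\<phi>\<close> at the barrier solution, and each
  of the \<open>m\<close> constraints contributes at most 1 to \<open>\<nabla>\<phi>\<close> paired with a feasible displacement
  (\<open>barrier_gradient_inner_le\<close>). The first-order inequality of strong convexity thus gives
  \<open>g x u - g x v + \<rho> / 2 * (norm (u - v))\<^sup>2 \<le> m * \<mu>\<close> for the barrier solution \<open>u\<close> and the
  constrained solution \<open>v\<close> (\<open>barrier_gap\<close>). Hence \<open>C\<^sub>g = m\<close> and \<open>C\<^sub>y = sqrt (2 m / \<rho>)\<close> work,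
  and the bound on \<open>\<nabla>\<^sub>y f\<close> carries the second estimate over to the outer objective.
\<close>

section \<open>Gradients, Jacobians and the symmetry of second derivatives\<close>

lemma gradient_eqI:
  assumes "GDERIV h z :> D"
  shows "gradient h z = D"
  unfolding gradient_def
proof (rule the_equality)
  fix E assume "GDERIV h z :> E"
  then have "(\<lambda>v. v \<bullet> E) = (\<lambda>v. v \<bullet> D)"
    using assms unfolding gderiv_def by (rule has_derivative_unique)
  then show "E = D"
    by (metis inner_commute vector_eq_ldot)
qed (fact assms)

lemma GDERIV_gradient:
  fixes h :: "'a::euclidean_space \<Rightarrow> real"
  assumes "h differentiable (at z)"
  shows "GDERIV h z :> gradient h z"
proof -
  obtain h' where h': "(h has_derivative h') (at z)"
    using assms unfolding differentiable_def by blast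
  then have "linear h'"
    by (rule has_derivative_linear)
  then have "h' = (\<lambda>v. v \<bullet> adjoint h' 1)"
    using adjoint_works[of h' _ 1] by (auto simp: inner_commute)
  then have "GDERIV h z :> adjoint h' 1"
    using h' unfolding gderiv_def by simp
  with gradient_eqI show ?thesis by metis
qed

lemma
  fixes h :: "'a::euclidean_space \<Rightarrow> 'b::euclidean_space \<Rightarrow> real"
  assumes "(\<lambda>(x, y). h x y) differentiable (at (x, y))"
  shows GDERIV_grad_x: "GDERIV (\<lambda>x'. h x' y) x :> grad_x h x y"
    and GDERIV_grad_y: "GDERIV (h x) y :> grad_y h x y"
    and gradient_pair: "gradient (\<lambda>(x, y). h x y) (x, y) = (grad_x h x y, grad_y h x y)"
proof -
  let ?D = "gradient (\<lambda>(x, y). h x y) (x, y)"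
  have D: "((\<lambda>(x, y). h x y) has_derivative (\<lambda>v. v \<bullet> ?D)) (at (x, y))"
    using GDERIV_gradient[OF assms] by (simp add: gderiv_def)
  have "((\<lambda>x'. (\<lambda>(x, y). h x y) (x', y)) has_derivative (\<lambda>v. (v, 0) \<bullet> ?D)) (at x)"
    by (rule has_derivative_compose[where f = "\<lambda>x'. (x', y)" and x = x, OF _ D]) (auto intro!: derivative_eq_intros)
  then have x: "GDERIV (\<lambda>x'. h x' y) x :> fst ?D"
    by (simp add: gderiv_def inner_prod_def)
  have "((\<lambda>y'. (\<lambda>(x, y). h x y) (x, y')) has_derivative (\<lambda>v. (0, v) \<bullet> ?D)) (at y)"
    by (rule has_derivative_compose[where f = "\<lambda>y'. (x, y')" and x = y, OF _ D]) (auto intro!: derivative_eq_intros)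
  then have y: "GDERIV (h x) y :> snd ?D"
    by (simp add: gderiv_def inner_prod_def)
  have eq: "grad_x h x y = fst ?D" "grad_y h x y = snd ?D"
    unfolding grad_x_def grad_y_def using x y by (auto intro: gradient_eqI)
  show "GDERIV (\<lambda>x'. h x' y) x :> grad_x h x y" "GDERIV (h x) y :> grad_y h x y"
    "?D = (grad_x h x y, grad_y h x y)"
    using x y eq by simp_all
qed

text \<open>
  Differentiability of the gradient at the single point \<open>y\<close> is enough for Schwarz's theorem.
  The second difference is an increment of \<open>s \<mapsto> h (y + s u + t v) - h (y + s u)\<close> over
  \<open>[0, t]\<close>, which the mean value theorem turns into a first difference of the gradient in
  direction \<open>t v\<close>, taken at two points within \<open>O(t)\<close> of \<open>y\<close>, where the linearization of
  the gradient at \<open>y\<close> applies.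
\<close>

lemma second_difference_approximation:
  fixes h :: "'a::euclidean_space \<Rightarrow> real"
  assumes h: "\<And>z. GDERIV h z :> \<Phi> z"
    and \<Phi>: "(\<Phi> has_derivative D) (at y)"
    and "e > 0"
  shows "eventually (\<lambda>t. \<bar>(h (y + t *\<^sub>R u + t *\<^sub>R v) - h (y + t *\<^sub>R u) - h (y + t *\<^sub>R v) + h y) / t\<^sup>2
            - u \<bullet> D v\<bar> \<le> e) (at_right 0)"
proof -
  \<comment> \<open>\<open>c\<close> dominates \<open>norm u\<close> times \<open>(norm a + norm a') / t\<close> for the displacements \<open>a\<close>, \<open>a'\<close>
        below; the summand 1 keeps it positive.\<close>
  define c where "c = norm u * (2 * norm u + norm v) + 1"
  have "c > 0"
    by (simp add: c_def add_nonneg_pos)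
  have "linear D"
    using \<Phi> by (rule has_derivative_linear)
  obtain d where "d > 0" and d:
    "\<And>z. norm (z - y) < d \<Longrightarrow> norm (\<Phi> z - \<Phi> y - D (z - y)) \<le> e / c * norm (z - y)"
    using \<Phi> \<open>e > 0\<close> \<open>c > 0\<close> unfolding has_derivative_at_alt by (meson divide_pos_pos)
  define r where "r = d / (norm u + norm v + 1)"
  have "r > 0"
    using \<open>d > 0\<close> by (simp add: r_def add_nonneg_pos)
  have "\<bar>(h (y + t *\<^sub>R u + t *\<^sub>R v) - h (y + t *\<^sub>R u) - h (y + t *\<^sub>R v) + h y) / t\<^sup>2 - u \<bullet> D v\<bar> \<le> e"
    if t: "0 < t" "t < r" for t
  proof -
    define p where "p s = h (y + s *\<^sub>R u + t *\<^sub>R v) - h (y + s *\<^sub>R u)" for s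
    have p: "(p has_derivative (\<lambda>k. k * (u \<bullet> (\<Phi> (y + s *\<^sub>R u + t *\<^sub>R v) - \<Phi> (y + s *\<^sub>R u)))))
        (at s within {0..t})" for s
    proof -
      have 1: "((\<lambda>s. h (y + s *\<^sub>R u + t *\<^sub>R v)) has_derivative
          (\<lambda>k. (k *\<^sub>R u) \<bullet> \<Phi> (y + s *\<^sub>R u + t *\<^sub>R v))) (at s within {0..t})"
        by (rule has_derivative_compose[OF _ h[unfolded gderiv_def]])
           (auto intro!: derivative_eq_intros)
      have 2: "((\<lambda>s. h (y + s *\<^sub>R u)) has_derivative
          (\<lambda>k. (k *\<^sub>R u) \<bullet> \<Phi> (y + s *\<^sub>R u))) (at s within {0..t})"
        by (rule has_derivative_compose[OF _ h[unfolded gderiv_def]])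
           (auto intro!: derivative_eq_intros)
      show ?thesis
        using has_derivative_diff[OF 1 2] unfolding p_def[abs_def]
        by (simp add: inner_diff_right algebra_simps)
    qed
    obtain s where s: "0 < s" "s < t"
      and ps: "p t - p 0 = t * (u \<bullet> (\<Phi> (y + s *\<^sub>R u + t *\<^sub>R v) - \<Phi> (y + s *\<^sub>R u)))"
      using mvt_simple[OF t(1) p] by auto
    define a where "a = s *\<^sub>R u + t *\<^sub>R v"
    define a' where "a' = s *\<^sub>R u"
    have na': "norm a' \<le> t * norm u"
      using s by (auto simp: a'_def intro: mult_right_mono)
    have na: "norm a \<le> t * norm u + t * norm v"
      unfolding a_def using norm_triangle_ineq[of "s *\<^sub>R u" "t *\<^sub>R v"] na' t(1)
      by (simp add: a'_def)
    have "t * norm u + t * norm v < d"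
    proof -
      have "t * (norm u + norm v) \<le> t * (norm u + norm v + 1)"
        using t(1) by simp
      also have "\<dots> < r * (norm u + norm v + 1)"
        using t(2) by (intro mult_strict_right_mono) (auto simp: add_nonneg_pos)
      also have "\<dots> = d"
        by (simp add: r_def add_nonneg_pos[THEN less_imp_neq, symmetric] field_simps add_nonneg_eq_0_iff)
      finally show ?thesis by (simp add: algebra_simps)
    qed
    moreover have "t * norm u \<le> t * norm u + t * norm v"
      using t(1) by simp
    ultimately have small: "norm a < d" "norm a' < d"
      using na na' by linarith+
    let ?err = "\<Phi> (y + a) - \<Phi> (y + a') - t *\<^sub>R D v"
    have "D a - D a' = t *\<^sub>R D v"
      using \<open>linear D\<close> by (simp add: a_def a'_def linear_add linear_scale)
    then have err_eq: "?err = (\<Phi> (y + a) - \<Phi> y - D a) - (\<Phi> (y + a') - \<Phi> y - D a')"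
      by (simp add: algebra_simps)
    have "norm ?err \<le> norm (\<Phi> (y + a) - \<Phi> y - D a) + norm (\<Phi> (y + a') - \<Phi> y - D a')"
      unfolding err_eq by (rule norm_triangle_ineq4)
    also have "\<dots> \<le> e / c * norm a + e / c * norm a'"
      using d[of "y + a"] d[of "y + a'"] small by (intro add_mono) auto
    also have "\<dots> \<le> e / c * (t * norm u + t * norm v) + e / c * (t * norm u)"
      using na na' \<open>e > 0\<close> \<open>c > 0\<close> by (intro add_mono mult_left_mono) auto
    finally have err: "norm ?err \<le> e / c * t * (2 * norm u + norm v)"
      by (simp add: algebra_simps)
    have "p t - p 0 = t * (u \<bullet> (\<Phi> (y + a) - \<Phi> (y + a')))"
      using ps by (simp add: a_def a'_def add.assoc)
    moreover have "u \<bullet> ?err = u \<bullet> (\<Phi> (y + a) - \<Phi> (y + a')) - t * (u \<bullet> D v)"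
      by (simp add: inner_diff_right)
    ultimately have "(p t - p 0) / t\<^sup>2 - u \<bullet> D v = (u \<bullet> ?err) / t"
      using t(1) by (simp add: power2_eq_square diff_divide_distrib)
    then have "\<bar>(p t - p 0) / t\<^sup>2 - u \<bullet> D v\<bar> \<le> norm u * norm ?err / t"
      using t(1) Cauchy_Schwarz_ineq2[of u ?err] by (simp add: divide_right_mono)
    also have "\<dots> \<le> norm u * (e / c * t * (2 * norm u + norm v)) / t"
      using err t(1) by (intro divide_right_mono mult_left_mono) auto
    also have "\<dots> = e * ((norm u * (2 * norm u + norm v)) / c)"
      using t(1) by simp
    also have "\<dots> = e * ((c - 1) / c)"
      by (simp add: c_def)
    also have "\<dots> \<le> e * 1"
      using \<open>e > 0\<close> \<open>c > 0\<close> by (intro mult_left_mono) auto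
    finally show ?thesis
      by (simp add: p_def algebra_simps)
  qed
  then show ?thesis
    unfolding eventually_at_right_field using \<open>r > 0\<close> by blast
qed

text \<open>
  The second difference is symmetric in \<open>u\<close> and \<open>v\<close>, and after division by \<open>t\<^sup>2\<close> it is
  close to both bilinear values.
\<close>

lemma derivative_of_gradient_symmetric:
  fixes h :: "'a::euclidean_space \<Rightarrow> real"
  assumes h: "\<And>z. GDERIV h z :> \<Phi> z"
    and \<Phi>: "(\<Phi> has_derivative D) (at y)"
  shows "u \<bullet> D v = D u \<bullet> v"
proof (rule ccontr)
  assume ne: "u \<bullet> D v \<noteq> D u \<bullet> v"
  define e where "e = \<bar>u \<bullet> D v - v \<bullet> D u\<bar> / 3"
  have "e > 0"
    using ne by (simp add: e_def inner_commute)
  let ?S = "\<lambda>u v t. (h (y + t *\<^sub>R u + t *\<^sub>R v) - h (y + t *\<^sub>R u) - h (y + t *\<^sub>R v) + h y) / t\<^sup>2"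
  have "eventually (\<lambda>t. \<bar>?S u v t - u \<bullet> D v\<bar> \<le> e \<and> \<bar>?S v u t - v \<bullet> D u\<bar> \<le> e) (at_right 0)"
    by (intro eventually_conj second_difference_approximation[OF h \<Phi> \<open>e > 0\<close>])
  then obtain t where t: "\<bar>?S u v t - u \<bullet> D v\<bar> \<le> e" "\<bar>?S v u t - v \<bullet> D u\<bar> \<le> e"
    using eventually_happens by (metis (lifting) trivial_limit_at_right_real)
  have "?S u v t = ?S v u t"
    by (simp add: algebra_simps)
  then have "\<bar>u \<bullet> D v - v \<bullet> D u\<bar> \<le> 2 * e"
    using t by linarith
  with \<open>e > 0\<close> show False
    by (simp add: e_def)
qed

lemma bounded_gradient_lipschitz:
  fixes h :: "'a::euclidean_space \<Rightarrow> real"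
  assumes D: "\<And>y. GDERIV h y :> D y" and le: "\<And>y. norm (D y) \<le> C"
  shows "\<bar>h u - h v\<bar> \<le> C * norm (u - v)"
proof -
  have "norm (h u - h v) \<le> C * norm (u - v)"
  proof (rule differentiable_bound[of UNIV])
    show "(h has_derivative (\<lambda>k. k \<bullet> D y)) (at y within UNIV)" for y
      using D by (simp add: gderiv_def)
    show "onorm (\<lambda>k. k \<bullet> D y) \<le> C" for y
    proof (rule onorm_le)
      fix k
      have "norm (k \<bullet> D y) \<le> norm k * norm (D y)"
        by (simp add: Cauchy_Schwarz_ineq2)
      also have "\<dots> \<le> norm k * C"
        using le by (intro mult_left_mono) auto
      finally show "norm (k \<bullet> D y) \<le> C * norm k"
        by (simp add: mult.commute)
    qed
  qed auto
  then show ?thesis by simp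
qed

lemma jacobian_vector_mult:
  fixes f :: "real^'n \<Rightarrow> real^'k"
  assumes "(f has_derivative f') (at x)"
  shows "jacobian f (at x) *v h = f' h"
  using frechet_derivative_at[OF assms] matrix_vector_mul(2)[OF has_derivative_linear[OF assms]]
  by (metis jacobian_def)

lemma
  fixes H :: "real^'k^'k"
  assumes "invertible H"
  shows matrix_inv_vector_mult: "matrix_inv H *v (H *v v) = v"
    and vector_mult_matrix_inv: "H *v (matrix_inv H *v v) = v"
proof -
  have "H ** matrix_inv H = mat 1 \<and> matrix_inv H ** H = mat 1"
    using assms unfolding invertible_def matrix_inv_def by (rule someI_ex)
  then show "matrix_inv H *v (H *v v) = v" "H *v (matrix_inv H *v v) = v"
    by (simp_all add: matrix_vector_mul_assoc)
qed

section \<open>Strong convexity and strong monotonicity\<close>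

text \<open>
  Dividing the defining inequality by \<open>t\<close> and letting \<open>t\<close> decrease to 0 turns its left-hand
  side into a directional derivative.
\<close>

lemma strongly_convex_first_order:
  fixes h :: "'a::euclidean_space \<Rightarrow> real"
  assumes "strongly_convex \<rho> h" and D: "GDERIV h u :> D"
  shows "h u + (v - u) \<bullet> D + \<rho> / 2 * (norm (v - u))\<^sup>2 \<le> h v"
proof -
  have "((\<lambda>t. h (u + t *\<^sub>R (v - u))) has_derivative (\<lambda>k. (k *\<^sub>R (v - u)) \<bullet> D)) (at 0)"
    by (rule has_derivative_compose[where g = h])
       (use D in \<open>auto simp: gderiv_def intro!: derivative_eq_intros\<close>)
  then have "((\<lambda>t. h (u + t *\<^sub>R (v - u))) has_real_derivative ((v - u) \<bullet> D)) (at 0)"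
    by (simp add: has_field_derivative_def mult_commute_abs)
  then have lim: "((\<lambda>t. (h (u + t *\<^sub>R (v - u)) - h u) / t) \<longlongrightarrow> (v - u) \<bullet> D) (at_right 0)"
    unfolding has_field_derivative_iff by (auto intro: filterlim_mono at_within_le_at simp: at_le)
  have rhs: "((\<lambda>t. h v - h u - \<rho> / 2 * (1 - t) * (norm (u - v))\<^sup>2) \<longlongrightarrow>
      h v - h u - \<rho> / 2 * (1 - 0) * (norm (u - v))\<^sup>2) (at_right 0)"
    by (intro tendsto_intros)
  have "(v - u) \<bullet> D \<le> h v - h u - \<rho> / 2 * (1 - 0) * (norm (u - v))\<^sup>2"
  proof (rule tendsto_le[OF _ rhs lim])
    have "(h (u + t *\<^sub>R (v - u)) - h u) / t \<le> h v - h u - \<rho> / 2 * (1 - t) * (norm (u - v))\<^sup>2"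
      if t: "0 < t" "t < 1" for t
    proof -
      have "h ((1 - t) *\<^sub>R u + t *\<^sub>R v)
          \<le> (1 - t) * h u + t * h v - \<rho> / 2 * t * (1 - t) * (norm (u - v))\<^sup>2"
        using assms(1) t unfolding strongly_convex_def by auto
      moreover have "(1 - t) *\<^sub>R u + t *\<^sub>R v = u + t *\<^sub>R (v - u)"
        by (simp add: algebra_simps)
      ultimately have "h (u + t *\<^sub>R (v - u)) - h u
          \<le> t * (h v - h u - \<rho> / 2 * (1 - t) * (norm (u - v))\<^sup>2)"
        by (simp add: algebra_simps)
      then show ?thesis
        using t(1) by (simp add: pos_divide_le_eq mult.commute)
    qed
    then show "eventually (\<lambda>t. (h (u + t *\<^sub>R (v - u)) - h u) / t
        \<le> h v - h u - \<rho> / 2 * (1 - t) * (norm (u - v))\<^sup>2) (at_right 0)"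
      unfolding eventually_at_right_field by (intro exI[of _ 1]) auto
  qed simp
  then show ?thesis
    by (simp add: norm_minus_commute)
qed

lemma strongly_convex_gradient_strongly_monotone:
  fixes h :: "'a::euclidean_space \<Rightarrow> real"
  assumes "strongly_convex \<rho> h" and "GDERIV h u :> Du" "GDERIV h v :> Dv"
  shows "\<rho> * (norm (v - u))\<^sup>2 \<le> (v - u) \<bullet> (Dv - Du)"
  using strongly_convex_first_order[OF assms(1,2), of v]
    strongly_convex_first_order[OF assms(1,3), of u]
  by (simp add: inner_diff_left inner_diff_right norm_minus_commute[of u v])

text \<open>
  The monotonicity inequality at \<open>z = y + t v\<close>, divided by \<open>t\<^sup>2\<close>, tends to the claim as
  \<open>t\<close> tends to 0.
\<close>

lemma strongly_monotone_derivative_coercive: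
  fixes \<Phi> :: "'a::real_inner \<Rightarrow> 'a"
  assumes \<Phi>: "(\<Phi> has_derivative D) (at y)"
    and mono: "eventually (\<lambda>z. \<rho> * (norm (z - y))\<^sup>2 \<le> (z - y) \<bullet> (\<Phi> z - \<Phi> y)) (nhds y)"
  shows "\<rho> * (norm v)\<^sup>2 \<le> v \<bullet> D v"
proof -
  have "((\<lambda>t. \<Phi> (y + t *\<^sub>R v)) has_derivative (\<lambda>k. D (k *\<^sub>R v))) (at 0)"
    by (rule has_derivative_compose[where g = \<Phi>])
       (use \<Phi> in \<open>auto intro!: derivative_eq_intros\<close>)
  then have "((\<lambda>t. v \<bullet> \<Phi> (y + t *\<^sub>R v)) has_derivative (\<lambda>k. v \<bullet> D (k *\<^sub>R v))) (at 0)"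
    by (intro derivative_intros)
  then have "((\<lambda>t. v \<bullet> \<Phi> (y + t *\<^sub>R v)) has_real_derivative v \<bullet> D v) (at 0)"
    using has_derivative_linear[OF \<Phi>]
    by (simp add: has_field_derivative_def linear_scale mult_commute_abs)
  then have lim: "((\<lambda>t. (v \<bullet> (\<Phi> (y + t *\<^sub>R v) - \<Phi> y)) / t) \<longlongrightarrow> v \<bullet> D v) (at 0)"
    unfolding has_field_derivative_iff by (simp add: inner_diff_right)
  have "((\<lambda>t. y + t *\<^sub>R v) \<longlongrightarrow> y + 0 *\<^sub>R v) (at 0)"
    by (intro tendsto_intros)
  then have "eventually (\<lambda>t. \<rho> * (norm (t *\<^sub>R v))\<^sup>2 \<le> (t *\<^sub>R v) \<bullet> (\<Phi> (y + t *\<^sub>R v) - \<Phi> y)) (at 0)"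
    using eventually_compose_filterlim[OF mono] by fastforce
  then have "eventually (\<lambda>t. \<rho> * (norm v)\<^sup>2 \<le> (v \<bullet> (\<Phi> (y + t *\<^sub>R v) - \<Phi> y)) / t) (at 0)"
    using eventually_neq_at_within[of 0 0 UNIV]
  proof eventually_elim
    case (elim t)
    then have "t\<^sup>2 * (\<rho> * (norm v)\<^sup>2) \<le> t\<^sup>2 * (v \<bullet> (\<Phi> (y + t *\<^sub>R v) - \<Phi> y) / t)"
      by (simp add: power_mult_distrib power2_eq_square field_simps)
    then show ?case
      using elim(2) mult_le_cancel_left_pos[of "t\<^sup>2"] zero_less_power2[of t] by blast
  qed
  then show ?thesis
    by (intro tendsto_lowerbound[OF lim]) auto
qed

section \<open>Differentiating a Lipschitz implicit solution\<close>

text \<open>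
  The differentiability part of the implicit function theorem. When a Lipschitz solution curve
  is already at hand, linearizing \<open>\<Phi>\<close> only at the one point is enough: the error
  \<open>o(norm (x - x0) + norm (Y x - Y x0))\<close> is \<open>o(norm (x - x0))\<close>, and applying the left inverse
  \<open>K\<close> of \<open>H\<close> isolates \<open>Y x - Y x0\<close>.
\<close>

lemma lipschitz_implicit_solution_has_derivative:
  fixes Y :: "'a::real_normed_vector \<Rightarrow> 'b::real_normed_vector"
    and \<Phi> :: "'a \<times> 'b \<Rightarrow> 'c::real_normed_vector"
  assumes \<Phi>: "(\<Phi> has_derivative (\<lambda>(h, k). B h + H k)) (at (x0, Y x0))"
    and zero: "\<And>x. \<Phi> (x, Y x) = 0"
    and lip: "C-lipschitz_on UNIV Y"
    and B: "bounded_linear B" and K: "bounded_linear K" and KH: "\<And>k. K (H k) = k"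
  shows "(Y has_derivative (\<lambda>h. - K (B h))) (at x0)"
  unfolding has_derivative_at_alt
proof (intro conjI allI impI)
  show "bounded_linear (\<lambda>h. - K (B h))"
    by (intro bounded_linear_minus bounded_linear_compose[OF K B])
  fix e :: real assume "e > 0"
  obtain M where "M > 0" and M: "\<And>z. norm (K z) \<le> norm z * M"
    using bounded_linear.pos_bounded[OF K] by blast
  have "C \<ge> 0"
    using lip by (rule lipschitz_on_nonneg)
  define e' where "e' = e / (M * (1 + C))"
  have "e' > 0"
    using \<open>e > 0\<close> \<open>M > 0\<close> \<open>C \<ge> 0\<close> by (simp add: e'_def)
  then obtain d where "d > 0" and d: "\<And>z. norm (z - (x0, Y x0)) < d \<Longrightarrow>
      norm (\<Phi> z - \<Phi> (x0, Y x0) - (\<lambda>(h, k). B h + H k) (z - (x0, Y x0))) \<le> e' * norm (z - (x0, Y x0))"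
    using \<Phi> unfolding has_derivative_at_alt by blast
  show "\<exists>d>0. \<forall>x. norm (x - x0) < d \<longrightarrow> norm (Y x - Y x0 - - K (B (x - x0))) \<le> e * norm (x - x0)"
  proof (intro exI[of _ "d / (1 + C)"] conjI allI impI)
    show "d / (1 + C) > 0"
      using \<open>d > 0\<close> \<open>C \<ge> 0\<close> by simp
    fix x assume x: "norm (x - x0) < d / (1 + C)"
    let ?r = "B (x - x0) + H (Y x - Y x0)"
    have "norm ((x, Y x) - (x0, Y x0)) \<le> norm (x - x0) + norm (Y x - Y x0)"
      using norm_Pair_le[of "x - x0" "Y x - Y x0"] by simp
    also have "\<dots> \<le> (1 + C) * norm (x - x0)"
      using lipschitz_onD[OF lip, of x x0] by (simp add: dist_norm algebra_simps)
    finally have n: "norm ((x, Y x) - (x0, Y x0)) \<le> (1 + C) * norm (x - x0)" .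
    also have "\<dots> < d"
      using x \<open>C \<ge> 0\<close> by (simp add: field_simps)
    finally have "norm ?r \<le> e' * norm ((x, Y x) - (x0, Y x0))"
      using d[of "(x, Y x)"] zero norm_minus_cancel[of ?r] by simp
    also have "\<dots> \<le> e' * ((1 + C) * norm (x - x0))"
      using n \<open>e' > 0\<close> by (intro mult_left_mono) auto
    finally have r: "norm ?r \<le> e' * ((1 + C) * norm (x - x0))" .
    have "Y x - Y x0 - - K (B (x - x0)) = K ?r"
      using KH by (simp add: linear_add[OF bounded_linear.linear[OF K]])
    then have "norm (Y x - Y x0 - - K (B (x - x0))) \<le> norm ?r * M"
      using M by simp
    also have "\<dots> \<le> e' * ((1 + C) * norm (x - x0)) * M"
      using r \<open>M > 0\<close> by (intro mult_right_mono) auto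
    also have "\<dots> = e * norm (x - x0)"
      using \<open>M > 0\<close> \<open>C \<ge> 0\<close> by (simp add: e'_def)
    finally show "norm (Y x - Y x0 - - K (B (x - x0))) \<le> e * norm (x - x0)" .
  qed
qed

section \<open>The logarithmic barrier of a polytope\<close>

text \<open>
  The slack is written with the row \<open>A $ i\<close>, since this row is also the direction of its
  gradient. A zero row has a constant slack and drops out of all derivatives of the barrier, so
  that only the slacks of nonzero rows have to be positive.
\<close>

definition slack :: "real^'k^'m \<Rightarrow> real^'m \<Rightarrow> real^'k \<Rightarrow> 'm \<Rightarrow> real" where
  "slack A b y i = b $ i - A $ i \<bullet> y"

lemma feasible_set_iff_slack: "y \<in> feasible_set A b \<longleftrightarrow> (\<forall>i. 0 \<le> slack A b y i)"
  by (simp add: feasible_set_def slack_def matrix_vector_mul_component)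

lemma log_barrier_slack: "log_barrier A b y = - (\<Sum>i\<in>UNIV. ln (slack A b y i))"
  by (simp add: log_barrier_def slack_def matrix_vector_mul_component)

definition barrier_gradient :: "real^'k^'m \<Rightarrow> real^'m \<Rightarrow> real^'k \<Rightarrow> real^'k" where
  "barrier_gradient A b y = (\<Sum>i\<in>UNIV. (1 / slack A b y i) *\<^sub>R A $ i)"

definition barrier_hessian :: "real^'k^'m \<Rightarrow> real^'m \<Rightarrow> real^'k \<Rightarrow> real^'k \<Rightarrow> real^'k" where
  "barrier_hessian A b y v = (\<Sum>i\<in>UNIV. ((A $ i \<bullet> v) / (slack A b y i)\<^sup>2) *\<^sub>R A $ i)"

text \<open>
  These two lemmas identify the interior of \<open>Y\<close> as the set of feasible points at which the
  constraints with nonzero rows are strict.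
\<close>

lemma interior_feasible_set_slack_pos:
  assumes "y \<in> interior (feasible_set A b)" "A $ i \<noteq> 0"
  shows "slack A b y i > 0"
proof -
  have "feasible_set A b \<subseteq> {y. A $ i \<bullet> y \<le> b $ i}"
    by (auto simp: feasible_set_iff_slack slack_def)
  then have "y \<in> interior {y. A $ i \<bullet> y \<le> b $ i}"
    using assms(1) interior_mono by blast
  then show ?thesis
    using assms(2) by (simp add: slack_def)
qed

lemma slack_pos_imp_interior_feasible_set:
  assumes "y \<in> feasible_set A b" and pos: "\<And>i. A $ i \<noteq> 0 \<Longrightarrow> slack A b y i > 0"
  shows "y \<in> interior (feasible_set A b)"
proof (rule interiorI)
  let ?U = "\<Inter>i\<in>{i. A $ i \<noteq> 0}. {z. A $ i \<bullet> z < b $ i}"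
  show "open ?U"
    by (intro open_INT) (auto simp: open_halfspace_lt)
  show "y \<in> ?U"
    using pos by (auto simp: slack_def)
  show "?U \<subseteq> feasible_set A b"
  proof
    fix z assume z: "z \<in> ?U"
    have "0 \<le> slack A b z i" for i
    proof (cases "A $ i = 0")
      case True
      then have "slack A b z i = slack A b y i"
        by (simp add: slack_def)
      then show ?thesis
        using assms(1) by (simp add: feasible_set_iff_slack)
    next
      case False
      then show ?thesis using z by (simp add: slack_def less_imp_le)
    qed
    then show "z \<in> feasible_set A b"
      by (simp add: feasible_set_iff_slack)
  qed
qed

lemma slack_diff: "slack A b u i - slack A b v i = - (A $ i \<bullet> (u - v))"
  by (simp add: slack_def inner_diff_right)

lemma slack_has_derivative [derivative_intros]:
  "((\<lambda>y. slack A b y i) has_derivative (\<lambda>v. - (A $ i \<bullet> v))) (at y within S)"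
  unfolding slack_def by (auto intro!: derivative_eq_intros)

lemma GDERIV_log_barrier:
  assumes "y \<in> interior (feasible_set A b)"
  shows "GDERIV (log_barrier A b) y :> barrier_gradient A b y"
proof -
  have "((\<lambda>y. ln (slack A b y i)) has_derivative (\<lambda>v. - (v \<bullet> A $ i) / slack A b y i)) (at y)" for i
  proof (cases "A $ i = 0")
    case True
    then show ?thesis by (simp add: slack_def)
  next
    case False
    then show ?thesis
      using interior_feasible_set_slack_pos[OF assms False]
      by (auto intro!: derivative_eq_intros simp: inner_commute divide_inverse)
  qed
  then have "((\<lambda>y. - (\<Sum>i\<in>UNIV. ln (slack A b y i))) has_derivative
      (\<lambda>v. - (\<Sum>i\<in>UNIV. - (v \<bullet> A $ i) / slack A b y i))) (at y)"
    by (intro derivative_intros)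
  moreover have "- (\<Sum>i\<in>UNIV. - (v \<bullet> A $ i) / slack A b y i) = v \<bullet> barrier_gradient A b y" for v
    by (simp add: barrier_gradient_def inner_sum_right sum_negf[symmetric])
  ultimately show ?thesis
    unfolding gderiv_def log_barrier_slack[abs_def] by simp
qed

lemma barrier_gradient_has_derivative:
  assumes "y \<in> interior (feasible_set A b)"
  shows "(barrier_gradient A b has_derivative barrier_hessian A b y) (at y)"
proof -
  have "((\<lambda>y. (1 / slack A b y i) *\<^sub>R A $ i) has_derivative
      (\<lambda>v. ((A $ i \<bullet> v) / (slack A b y i)\<^sup>2) *\<^sub>R A $ i)) (at y)" for i
  proof (cases "A $ i = 0")
    case False
    then show ?thesis
      using interior_feasible_set_slack_pos[OF assms False]
      by (auto intro!: derivative_eq_intros simp: power2_eq_square divide_inverse mult_ac)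
  qed simp
  then have "((\<lambda>y. \<Sum>i\<in>UNIV. (1 / slack A b y i) *\<^sub>R A $ i) has_derivative
      (\<lambda>v. \<Sum>i\<in>UNIV. ((A $ i \<bullet> v) / (slack A b y i)\<^sup>2) *\<^sub>R A $ i)) (at y)"
    by (rule has_derivative_sum)
  then show ?thesis
    unfolding barrier_gradient_def[abs_def] barrier_hessian_def[abs_def] .
qed

lemma barrier_hessian_symmetric: "u \<bullet> barrier_hessian A b y v = barrier_hessian A b y u \<bullet> v"
  by (simp add: barrier_hessian_def inner_sum_left inner_sum_right inner_commute mult_ac)

text \<open>
  Each summand of the barrier is a decreasing function of a slack with increasing derivative:
  with slacks \<open>s\<close>, \<open>t\<close> at the two points, row \<open>i\<close> contributes
  \<open>(1 / s - 1 / t) * (t - s) = (t - s)\<^sup>2 / (s * t)\<close>.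
\<close>

lemma barrier_gradient_monotone:
  assumes "u \<in> interior (feasible_set A b)" "v \<in> interior (feasible_set A b)"
  shows "0 \<le> (u - v) \<bullet> (barrier_gradient A b u - barrier_gradient A b v)"
proof -
  have "0 \<le> (1 / slack A b u i - 1 / slack A b v i) * (A $ i \<bullet> (u - v))" for i
  proof (cases "A $ i = 0")
    case False
    let ?s = "slack A b u i" and ?t = "slack A b v i"
    have pos: "?s > 0" "?t > 0"
      using interior_feasible_set_slack_pos assms False by blast+
    have "A $ i \<bullet> (u - v) = ?t - ?s"
      using slack_diff[of A b u i v] by linarith
    moreover have "(1 / s - 1 / t) * (t - s) = (t - s)\<^sup>2 / (s * t)" if "s > 0" "t > 0" for s t :: real
      using that by (simp add: field_simps power2_eq_square)
    ultimately show ?thesis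
      using pos by simp
  qed simp
  then have "0 \<le> (\<Sum>i\<in>UNIV. (1 / slack A b u i - 1 / slack A b v i) * (A $ i \<bullet> (u - v)))"
    by (intro sum_nonneg) auto
  also have "\<dots> = (u - v) \<bullet> (barrier_gradient A b u - barrier_gradient A b v)"
    by (simp add: barrier_gradient_def inner_sum_right inner_diff_right sum_subtractf
        left_diff_distrib inner_commute inner_diff_left)
  finally show ?thesis .
qed

text \<open>
  This is the source of the bound \<open>m \<mu>\<close> on the suboptimality. Along \<open>v - u\<close>, row \<open>i\<close>
  contributes \<open>1 - slack v / slack u\<close>, which is at most 1 however close \<open>u\<close> is to the boundary.
\<close>

lemma barrier_gradient_inner_le:
  fixes A :: "real^'k^'m"
  assumes "u \<in> interior (feasible_set A b)" "v \<in> feasible_set A b"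
  shows "(v - u) \<bullet> barrier_gradient A b u \<le> real CARD('m)"
proof -
  have "(A $ i \<bullet> (v - u)) / slack A b u i \<le> 1" for i
  proof (cases "A $ i = 0")
    case False
    have "slack A b u i > 0"
      using interior_feasible_set_slack_pos[OF assms(1) False] .
    moreover have "slack A b v i \<ge> 0"
      using assms(2) by (simp add: feasible_set_iff_slack)
    ultimately show ?thesis
      using slack_diff[of A b v i u] by (simp add: divide_le_eq_1)
  qed simp
  then have "(\<Sum>i\<in>UNIV. (A $ i \<bullet> (v - u)) / slack A b u i) \<le> (\<Sum>i\<in>(UNIV::'m set). 1)"
    by (intro sum_mono)
  then show ?thesis
    by (simp add: barrier_gradient_def inner_sum_right inner_commute)
qed

lemma log_barrier_lower_bound:
  fixes A :: "real^'k^'m"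
  assumes y: "y \<in> feasible_set A b" and M: "M \<ge> 1" "\<And>i. slack A b y i \<le> M"
  shows "- ln (slack A b y j) - real CARD('m) * ln M \<le> log_barrier A b y"
proof -
  have le: "ln (slack A b y i) \<le> ln M" for i
  proof (cases "slack A b y i = 0")
    case False
    then have "slack A b y i > 0"
      using y by (simp add: feasible_set_iff_slack less_le)
    then show ?thesis
      using M by (simp add: ln_mono)
  qed (use M in simp)
  have "(\<Sum>i\<in>UNIV. ln (slack A b y i)) = ln (slack A b y j) + (\<Sum>i\<in>UNIV - {j}. ln (slack A b y i))"
    by (rule sum.remove) auto
  also have "(\<Sum>i\<in>UNIV - {j}. ln (slack A b y i)) \<le> (\<Sum>i\<in>UNIV - {j}. ln M)"
    using le by (intro sum_mono)
  also have "\<dots> \<le> (\<Sum>i\<in>(UNIV::'m set). ln M)"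
    using M by (intro sum_mono2) auto
  finally show ?thesis
    by (simp add: log_barrier_slack)
qed

text \<open>
  The slacks are bounded above on the compact set \<open>Y\<close>, so a single small slack makes the
  barrier large. Points with a slack below a suitable \<open>\<delta>\<close> are therefore worse than a reference
  point \<open>y0\<close>, and the remaining points form a compact subset of the interior, on which the
  objective is continuous.
\<close>

lemma barrier_attains_minimum:
  fixes A :: "real^'k^'m"
  assumes compact: "compact (feasible_set A b)" and ne: "interior (feasible_set A b) \<noteq> {}"
    and h: "continuous_on (feasible_set A b) h" and "\<mu> > 0"
  obtains y where "y \<in> interior (feasible_set A b)"
    "\<And>z. z \<in> interior (feasible_set A b) \<Longrightarrow>
      h y + \<mu> * log_barrier A b y \<le> h z + \<mu> * log_barrier A b z"
proof -
  let ?Y = "feasible_set A b" and ?I = "interior (feasible_set A b)"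
  let ?\<psi> = "\<lambda>y. h y + \<mu> * log_barrier A b y"
  obtain y0 where y0: "y0 \<in> ?I"
    using ne by blast
  have I_Y: "?I \<subseteq> ?Y"
    by (rule interior_subset)
  obtain y1 where y1: "\<And>y. y \<in> ?Y \<Longrightarrow> h y1 \<le> h y"
    using continuous_attains_inf[OF compact _ h] y0 I_Y by blast
  have cont_slack: "continuous_on S (\<lambda>y. slack A b y i)" for S i
    unfolding slack_def by (intro continuous_intros)
  have "\<exists>m. \<forall>y\<in>?Y. slack A b y i \<le> m" for i
    using continuous_attains_sup[OF compact _ cont_slack[of _ i]] y0 I_Y by blast
  then obtain m where m: "\<And>i y. y \<in> ?Y \<Longrightarrow> slack A b y i \<le> m i"
    by metis
  define M where "M = max 1 (Max (range m))"
  have "m i \<le> M" for i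
    unfolding M_def by (intro max.coboundedI2 Max_ge) auto
  with m have M: "M \<ge> 1" "\<And>i y. y \<in> ?Y \<Longrightarrow> slack A b y i \<le> M"
    by (fastforce simp: M_def intro: order_trans)+
  \<comment> \<open>With this \<open>\<delta>\<close>, the lower bound of the barrier at a point with a slack below \<open>\<delta>\<close>
        exceeds \<open>(\<psi> y0 - h y1) / \<mu>\<close>.\<close>
  define \<delta> where "\<delta> = exp (- ((?\<psi> y0 - h y1) / \<mu> + real CARD('m) * ln M))"
  define K where "K = {y \<in> ?Y. \<forall>i. A $ i \<noteq> 0 \<longrightarrow> \<delta> \<le> slack A b y i}"
  have outside: "?\<psi> y0 < ?\<psi> y" if y: "y \<in> ?I" "y \<notin> K" for y
  proof -
    obtain i where i: "A $ i \<noteq> 0" "slack A b y i < \<delta>"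
      using y I_Y by (auto simp: K_def not_le)
    have pos: "slack A b y i > 0"
      using interior_feasible_set_slack_pos[OF y(1) i(1)] .
    then have "ln (slack A b y i) < ln \<delta>"
      using i(2) ln_less_cancel_iff[OF pos, of \<delta>] by linarith
    then have "(?\<psi> y0 - h y1) / \<mu> < - ln (slack A b y i) - real CARD('m) * ln M"
      by (simp add: \<delta>_def)
    also have "\<dots> \<le> log_barrier A b y"
      using y(1) I_Y M by (intro log_barrier_lower_bound) auto
    finally have "?\<psi> y0 - h y1 < \<mu> * log_barrier A b y"
      using \<open>\<mu> > 0\<close> by (simp add: pos_divide_less_eq mult.commute)
    then show ?thesis
      using y1[of y] y(1) I_Y by auto
  qed
  have "K \<subseteq> ?I"
  proof
    fix y assume "y \<in> K"
    moreover have "\<delta> > 0"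
      by (simp add: \<delta>_def)
    ultimately show "y \<in> ?I"
      unfolding K_def by (intro slack_pos_imp_interior_feasible_set) (auto intro: less_le_trans)
  qed
  have "K = ?Y \<inter> (\<Inter>i\<in>{i. A $ i \<noteq> 0}. {y. \<delta> \<le> slack A b y i})"
    by (auto simp: K_def)
  moreover have "closed {y. \<delta> \<le> slack A b y i}" for i
    by (intro closed_Collect_le continuous_on_const cont_slack)
  ultimately have "compact K"
    using compact by (auto intro!: compact_Int_closed)
  moreover have "y0 \<in> K"
    using outside[OF y0] by auto
  moreover have "continuous_on K ?\<psi>"
  proof (intro continuous_intros)
    show "continuous_on K h"
      using h by (rule continuous_on_subset) (auto simp: K_def)
    show "continuous_on K (log_barrier A b)"
      using GDERIV_log_barrier \<open>K \<subseteq> ?I\<close> unfolding gderiv_def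
      by (meson continuous_at_imp_continuous_on has_derivative_continuous subsetD)
  qed
  ultimately obtain y where y: "y \<in> K" "\<And>z. z \<in> K \<Longrightarrow> ?\<psi> y \<le> ?\<psi> z"
    using continuous_attains_inf[of K ?\<psi>] by blast
  show thesis
  proof (rule that)
    show "y \<in> ?I"
      using y \<open>K \<subseteq> ?I\<close> by blast
    fix z assume "z \<in> ?I"
    then show "?\<psi> y \<le> ?\<psi> z"
      using y(2)[of z] y(2)[OF \<open>y0 \<in> K\<close>] outside[of z] by (cases "z \<in> K") auto
  qed
qed

section \<open>The barrier solution and its uniqueness\<close>

locale barrier_lower_problem =
  fixes A :: "real^'k^'m" and b :: "real^'m" and g :: "real^'n \<Rightarrow> real^'k \<Rightarrow> real"
    and \<rho> L :: real
  assumes compact_feasible: "compact (feasible_set A b)"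
    and interior_nonempty: "interior (feasible_set A b) \<noteq> {}"
    and rho_pos: "\<rho> > 0"
    and strongly_convex: "strongly_convex \<rho> (g x)"
    and g_differentiable: "(\<lambda>(x, y). g x y) differentiable (at z)"
    and gradient_differentiable: "gradient (\<lambda>(x, y). g x y) differentiable (at z)"
    and gradient_lipschitz: "L-lipschitz_on UNIV (gradient (\<lambda>(x, y). g x y))"
begin

abbreviation "int_Y \<equiv> interior (feasible_set A b)"
abbreviation "\<psi> \<equiv> barrier_objective A b g"
abbreviation "y\<^sub>\<mu> \<equiv> barrier_solution A b g"
abbreviation "y_opt \<equiv> lower_solution A b g"

lemma GDERIV_g: "GDERIV (g x) y :> grad_y g x y"
  using g_differentiable by (rule GDERIV_grad_y)

lemma continuous_g: "continuous_on S (g x)"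
  using GDERIV_g unfolding gderiv_def
  by (meson continuous_at_imp_continuous_on has_derivative_continuous)

lemma grad_y_g_eq: "grad_y g x y = snd (gradient (\<lambda>(x, y). g x y) (x, y))"
  using gradient_pair[OF g_differentiable] by simp

lemma
  assumes "y \<in> int_Y"
  shows GDERIV_barrier_objective: "GDERIV (\<psi> \<mu> x) y :> grad_y (\<psi> \<mu>) x y"
    and grad_y_barrier_objective:
      "grad_y (\<psi> \<mu>) x y = grad_y g x y + \<mu> *\<^sub>R barrier_gradient A b y"
proof -
  have "GDERIV (\<psi> \<mu> x) y :> grad_y g x y + \<mu> *\<^sub>R barrier_gradient A b y"
    using GDERIV_add[OF GDERIV_g GDERIV_mult[OF GDERIV_const GDERIV_log_barrier[OF assms]], of x \<mu>]
    unfolding barrier_objective_def[abs_def] by simp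
  moreover from this show "grad_y (\<psi> \<mu>) x y = grad_y g x y + \<mu> *\<^sub>R barrier_gradient A b y"
    unfolding grad_y_def by (rule gradient_eqI)
  ultimately show "GDERIV (\<psi> \<mu> x) y :> grad_y (\<psi> \<mu>) x y"
    by simp
qed

lemma grad_y_barrier_objective_strongly_monotone:
  assumes "u \<in> int_Y" "v \<in> int_Y" "\<mu> > 0"
  shows "\<rho> * (norm (v - u))\<^sup>2 \<le> (v - u) \<bullet> (grad_y (\<psi> \<mu>) x v - grad_y (\<psi> \<mu>) x u)"
proof -
  have "(v - u) \<bullet> (grad_y (\<psi> \<mu>) x v - grad_y (\<psi> \<mu>) x u)
      = (v - u) \<bullet> (grad_y g x v - grad_y g x u)
        + \<mu> * ((v - u) \<bullet> (barrier_gradient A b v - barrier_gradient A b u))"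
    using assms by (simp add: grad_y_barrier_objective inner_diff_right inner_add_right algebra_simps)
  moreover have "0 \<le> \<mu> * ((v - u) \<bullet> (barrier_gradient A b v - barrier_gradient A b u))"
    using barrier_gradient_monotone[OF assms(2,1)] assms(3) by simp
  ultimately show ?thesis
    using strongly_convex_gradient_strongly_monotone[OF strongly_convex[of x] GDERIV_g[of x u] GDERIV_g[of x v]]
    by linarith
qed

lemma minimizer_stationary:
  assumes "is_arg_min (\<psi> \<mu> x) (\<lambda>y. y \<in> int_Y) y"
  shows "grad_y (\<psi> \<mu>) x y = 0"
proof -
  have y: "y \<in> int_Y" "\<forall>z\<in>int_Y. \<psi> \<mu> x y \<le> \<psi> \<mu> x z"
    using assms by (auto simp: is_arg_min_linorder)
  have "(\<lambda>v. v \<bullet> grad_y (\<psi> \<mu>) x y) = (\<lambda>v. 0)"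
    by (rule differential_zero_maxmin[OF y(1) open_interior
          GDERIV_barrier_objective[OF y(1), unfolded gderiv_def]])
       (use y(2) in blast)
  then show ?thesis
    by (metis inner_eq_zero_iff)
qed

lemma ex1_barrier_minimizer:
  assumes "\<mu> > 0"
  shows "\<exists>!y. is_arg_min (\<psi> \<mu> x) (\<lambda>y. y \<in> int_Y) y"
proof (rule ex_ex1I)
  obtain y where "y \<in> int_Y" "\<And>z. z \<in> int_Y \<Longrightarrow> \<psi> \<mu> x y \<le> \<psi> \<mu> x z"
    using barrier_attains_minimum[OF compact_feasible interior_nonempty continuous_g assms]
    unfolding barrier_objective_def by blast
  then show "\<exists>y. is_arg_min (\<psi> \<mu> x) (\<lambda>y. y \<in> int_Y) y"
    by (auto simp: is_arg_min_linorder)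
next
  fix u v assume uv: "is_arg_min (\<psi> \<mu> x) (\<lambda>y. y \<in> int_Y) u"
    "is_arg_min (\<psi> \<mu> x) (\<lambda>y. y \<in> int_Y) v"
  then have "\<rho> * (norm (v - u))\<^sup>2 \<le> 0"
    using grad_y_barrier_objective_strongly_monotone[of u v \<mu> x] assms minimizer_stationary
    by (simp add: is_arg_min_def)
  then show "u = v"
    using rho_pos by (simp add: mult_le_0_iff)
qed

lemma barrier_solution_minimizes:
  assumes "\<mu> > 0"
  shows "is_arg_min (\<psi> \<mu> x) (\<lambda>y. y \<in> int_Y) (y\<^sub>\<mu> \<mu> x)"
  unfolding barrier_solution_def arg_min_on_def arg_min_def
  using ex1_barrier_minimizer[OF assms] by (metis (lifting) someI_ex)

lemma barrier_solution_interior: "\<mu> > 0 \<Longrightarrow> y\<^sub>\<mu> \<mu> x \<in> int_Y"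
  using barrier_solution_minimizes by (simp add: is_arg_min_def)

lemma barrier_solution_stationary: "\<mu> > 0 \<Longrightarrow> grad_y (\<psi> \<mu>) x (y\<^sub>\<mu> \<mu> x) = 0"
  using barrier_solution_minimizes by (rule minimizer_stationary)

section \<open>Differentiability of the barrier solution and the hypergradient\<close>

text \<open>
  Both solutions are stationary, so the change of the \<open>y\<close>-gradient between them can be moved
  into its \<open>x\<close> argument. There the barrier cancels, which leaves the Lipschitz constant of the
  gradient of \<open>g\<close>; strong monotonicity gives the bound, with a constant independent of \<open>\<mu>\<close>.
\<close>

lemma barrier_solution_lipschitz:
  assumes "\<mu> > 0"
  shows "(L / \<rho>)-lipschitz_on UNIV (y\<^sub>\<mu> \<mu>)"
proof (rule lipschitz_onI)
  have "L \<ge> 0"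
    using gradient_lipschitz by (rule lipschitz_on_nonneg)
  then show "0 \<le> L / \<rho>"
    using rho_pos by simp
  fix x x'
  let ?u = "y\<^sub>\<mu> \<mu> x" and ?v = "y\<^sub>\<mu> \<mu> x'"
  have I: "?u \<in> int_Y" "?v \<in> int_Y"
    using barrier_solution_interior[OF assms] by auto
  have "grad_y (\<psi> \<mu>) x ?v - grad_y (\<psi> \<mu>) x ?u = grad_y (\<psi> \<mu>) x ?v - grad_y (\<psi> \<mu>) x' ?v"
    using barrier_solution_stationary[OF assms] by simp
  also have "\<dots> = grad_y g x ?v - grad_y g x' ?v"
    using I by (simp add: grad_y_barrier_objective)
  finally have diff: "grad_y (\<psi> \<mu>) x ?v - grad_y (\<psi> \<mu>) x ?u = grad_y g x ?v - grad_y g x' ?v" .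
  have "norm (grad_y g x ?v - grad_y g x' ?v)
      \<le> dist (gradient (\<lambda>(x, y). g x y) (x, ?v)) (gradient (\<lambda>(x, y). g x y) (x', ?v))"
    unfolding grad_y_g_eq dist_norm[symmetric] by (rule dist_snd_le)
  also have "\<dots> \<le> L * dist (x, ?v) (x', ?v)"
    by (intro lipschitz_onD[OF gradient_lipschitz]) auto
  also have "\<dots> = L * dist x x'"
    by (simp add: dist_Pair_Pair)
  finally have G: "norm (grad_y g x ?v - grad_y g x' ?v) \<le> L * dist x x'" .
  have "\<rho> * (norm (?v - ?u))\<^sup>2 \<le> (?v - ?u) \<bullet> (grad_y g x ?v - grad_y g x' ?v)"
    using grad_y_barrier_objective_strongly_monotone[OF I assms, of x] unfolding diff .
  also have "\<dots> \<le> norm (?v - ?u) * norm (grad_y g x ?v - grad_y g x' ?v)"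
    by (rule norm_cauchy_schwarz)
  also have "\<dots> \<le> norm (?v - ?u) * (L * dist x x')"
    using G by (intro mult_left_mono) auto
  finally have "norm (?v - ?u) * (\<rho> * norm (?v - ?u)) \<le> norm (?v - ?u) * (L * dist x x')"
    by (simp add: power2_eq_square mult_ac)
  then have "\<rho> * norm (?v - ?u) \<le> L * dist x x'"
    using \<open>L \<ge> 0\<close> by (cases "?v = ?u") (auto simp: mult_le_cancel_left)
  then show "dist ?u ?v \<le> L / \<rho> * dist x x'"
    using rho_pos by (simp add: dist_norm norm_minus_commute field_simps)
qed

text \<open>
  The explicit expression \<open>grad_y g x y + \<mu> *\<^sub>R barrier_gradient A b y\<close> is differentiable in
  both variables jointly at interior points; its partial derivatives are the Hessian blocks of
  \<open>\<psi>\<close>, because it agrees with \<open>grad_y (\<psi> \<mu>) x y\<close> on the open interior. The symmetry of the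
  \<open>yy\<close> block comes from Schwarz's theorem for \<open>g x\<close> and the explicit form of the barrier
  Hessian.
\<close>

lemma
  assumes y: "y \<in> int_Y"
  shows stationarity_map_has_derivative:
      "((\<lambda>(x, y). grad_y g x y + \<mu> *\<^sub>R barrier_gradient A b y) has_derivative
        (\<lambda>(h, k). hess_xy (\<psi> \<mu>) x y *v h + hess_yy (\<psi> \<mu>) x y *v k)) (at (x, y))"
    and grad_y_has_derivative_hess_yy:
      "((\<lambda>y. grad_y (\<psi> \<mu>) x y) has_derivative (\<lambda>k. hess_yy (\<psi> \<mu>) x y *v k)) (at y)"
    and hess_yy_symmetric: "u \<bullet> (hess_yy (\<psi> \<mu>) x y *v v) = (hess_yy (\<psi> \<mu>) x y *v u) \<bullet> v"
proof -
  let ?G = "gradient (\<lambda>(x, y). g x y)"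
  obtain D where D: "(?G has_derivative D) (at (x, y))"
    using gradient_differentiable unfolding differentiable_def by blast
  have Dx: "((\<lambda>x'. grad_y g x' y) has_derivative (\<lambda>h. snd (D (h, 0)))) (at x)"
    unfolding grad_y_g_eq
    by (intro has_derivative_snd has_derivative_compose[where f = "\<lambda>x'. (x', y)" and x = x, OF _ D])
       (auto intro!: derivative_eq_intros)
  have Dy: "((\<lambda>y'. grad_y g x y') has_derivative (\<lambda>k. snd (D (0, k)))) (at y)"
    unfolding grad_y_g_eq
    by (intro has_derivative_snd has_derivative_compose[where f = "\<lambda>y'. (x, y')" and x = y, OF _ D])
       (auto intro!: derivative_eq_intros)
  have "((\<lambda>x'. grad_y (\<psi> \<mu>) x' y) has_derivative (\<lambda>h. snd (D (h, 0)))) (at x)"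
    unfolding grad_y_barrier_objective[OF y] using Dx by (auto intro!: derivative_eq_intros)
  then have xy: "hess_xy (\<psi> \<mu>) x y *v h = snd (D (h, 0))" for h
    unfolding hess_xy_def by (rule jacobian_vector_mult)
  have "((\<lambda>y'. grad_y g x y' + \<mu> *\<^sub>R barrier_gradient A b y') has_derivative
      (\<lambda>k. snd (D (0, k)) + \<mu> *\<^sub>R barrier_hessian A b y k)) (at y)"
    by (intro derivative_intros Dy barrier_gradient_has_derivative y)
  then have Dyy: "((\<lambda>y. grad_y (\<psi> \<mu>) x y) has_derivative
      (\<lambda>k. snd (D (0, k)) + \<mu> *\<^sub>R barrier_hessian A b y k)) (at y)"
    by (rule has_derivative_transform_within_open[of _ _ _ _ int_Y])
       (use y in \<open>auto simp: grad_y_barrier_objective\<close>)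
  then have yy: "hess_yy (\<psi> \<mu>) x y *v k = snd (D (0, k)) + \<mu> *\<^sub>R barrier_hessian A b y k" for k
    unfolding hess_yy_def by (rule jacobian_vector_mult)
  show "((\<lambda>y. grad_y (\<psi> \<mu>) x y) has_derivative (\<lambda>k. hess_yy (\<psi> \<mu>) x y *v k)) (at y)"
    using Dyy by (simp add: yy)
  have split: "(\<lambda>v. snd (D v) + \<mu> *\<^sub>R barrier_hessian A b y (snd v))
      = (\<lambda>(h, k). hess_xy (\<psi> \<mu>) x y *v h + hess_yy (\<psi> \<mu>) x y *v k)"
  proof (clarsimp simp: fun_eq_iff xy yy)
    fix h k
    show "snd (D (h, k)) = snd (D (h, 0)) + snd (D (0, k))"
      using linear_add[OF has_derivative_linear[OF D], of "(h, 0)" "(0, k)"] by simp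
  qed
  have "((\<lambda>z. snd (?G z) + \<mu> *\<^sub>R barrier_gradient A b (snd z)) has_derivative
      (\<lambda>v. snd (D v) + \<mu> *\<^sub>R barrier_hessian A b y (snd v))) (at (x, y))"
    by (intro derivative_intros has_derivative_snd D
        has_derivative_compose[of snd snd "(x, y)" UNIV "barrier_gradient A b"])
       (use barrier_gradient_has_derivative[OF y] in \<open>auto intro!: derivative_eq_intros\<close>)
  then show "((\<lambda>(x, y). grad_y g x y + \<mu> *\<^sub>R barrier_gradient A b y) has_derivative
        (\<lambda>(h, k). hess_xy (\<psi> \<mu>) x y *v h + hess_yy (\<psi> \<mu>) x y *v k)) (at (x, y))"
    unfolding split by (simp add: grad_y_g_eq case_prod_unfold)
  show "u \<bullet> (hess_yy (\<psi> \<mu>) x y *v v) = (hess_yy (\<psi> \<mu>) x y *v u) \<bullet> v"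
    using derivative_of_gradient_symmetric[OF GDERIV_g Dy, of u v]
      barrier_hessian_symmetric[of u A b y v]
    by (simp add: yy inner_add_left inner_add_right)
qed

lemma hess_yy_coercive:
  assumes "y \<in> int_Y" "\<mu> > 0"
  shows "\<rho> * (norm v)\<^sup>2 \<le> v \<bullet> (hess_yy (\<psi> \<mu>) x y *v v)"
proof (rule strongly_monotone_derivative_coercive[OF grad_y_has_derivative_hess_yy[OF assms(1)]])
  have "eventually (\<lambda>z. z \<in> int_Y) (nhds y)"
    using assms(1) by (intro eventually_nhds_in_open) auto
  then show "eventually (\<lambda>z. \<rho> * (norm (z - y))\<^sup>2
      \<le> (z - y) \<bullet> (grad_y (\<psi> \<mu>) x z - grad_y (\<psi> \<mu>) x y)) (nhds y)"
    by eventually_elim (use grad_y_barrier_objective_strongly_monotone assms in blast)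
qed

lemma invertible_hess_yy:
  assumes "y \<in> int_Y" "\<mu> > 0"
  shows "invertible (hess_yy (\<psi> \<mu>) x y)"
proof -
  have "v = 0" if "hess_yy (\<psi> \<mu>) x y *v v = 0" for v
    using hess_yy_coercive[OF assms, of v x] that rho_pos by (simp add: mult_le_0_iff)
  then have "inj ((*v) (hess_yy (\<psi> \<mu>) x y))"
    by (simp add: linear_injective_0[OF matrix_vector_mul_linear])
  then show ?thesis
    by (simp add: invertible_left_inverse matrix_left_invertible_injective)
qed

lemma barrier_solution_has_derivative:
  assumes "\<mu> > 0"
  shows "(y\<^sub>\<mu> \<mu> has_derivative (\<lambda>h. - (matrix_inv (hess_yy (\<psi> \<mu>) x (y\<^sub>\<mu> \<mu> x))
            *v (hess_xy (\<psi> \<mu>) x (y\<^sub>\<mu> \<mu> x) *v h)))) (at x)"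
proof (rule lipschitz_implicit_solution_has_derivative[where
      \<Phi> = "\<lambda>(x, y). grad_y g x y + \<mu> *\<^sub>R barrier_gradient A b y"
      and B = "\<lambda>h. hess_xy (\<psi> \<mu>) x (y\<^sub>\<mu> \<mu> x) *v h"
      and H = "\<lambda>k. hess_yy (\<psi> \<mu>) x (y\<^sub>\<mu> \<mu> x) *v k"
      and K = "\<lambda>k. matrix_inv (hess_yy (\<psi> \<mu>) x (y\<^sub>\<mu> \<mu> x)) *v k"])
  note I = barrier_solution_interior[OF assms]
  show "((\<lambda>(x, y). grad_y g x y + \<mu> *\<^sub>R barrier_gradient A b y) has_derivative
      (\<lambda>(h, k). hess_xy (\<psi> \<mu>) x (y\<^sub>\<mu> \<mu> x) *v h + hess_yy (\<psi> \<mu>) x (y\<^sub>\<mu> \<mu> x) *v k)) (at (x, y\<^sub>\<mu> \<mu> x))"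
    using stationarity_map_has_derivative[OF I] .
  show "(\<lambda>(x, y). grad_y g x y + \<mu> *\<^sub>R barrier_gradient A b y) (x', y\<^sub>\<mu> \<mu> x') = 0" for x'
    using barrier_solution_stationary[OF assms, of x'] grad_y_barrier_objective[OF I] by simp
  show "(L / \<rho>)-lipschitz_on UNIV (y\<^sub>\<mu> \<mu>)"
    using barrier_solution_lipschitz[OF assms] .
  show "matrix_inv (hess_yy (\<psi> \<mu>) x (y\<^sub>\<mu> \<mu> x)) *v (hess_yy (\<psi> \<mu>) x (y\<^sub>\<mu> \<mu> x) *v k) = k" for k
    using matrix_inv_vector_mult[OF invertible_hess_yy[OF I assms]] .
qed (rule matrix_vector_mul_bounded_linear)+

text \<open>
  The chain rule produces the adjoint of the derivative of the solution map, in which the inverse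
  of the Hessian appears transposed; symmetry of the Hessian removes the transpose.
\<close>

lemma GDERIV_barrier_outer_objective:
  assumes f: "\<And>z. (\<lambda>(x, y). f x y) differentiable (at z)" and "\<mu> > 0"
  defines "y \<equiv> \<lambda>x. y\<^sub>\<mu> \<mu> x"
  shows "GDERIV (barrier_outer_objective A b f g \<mu>) x :>
      grad_x f x (y x) - transpose (hess_xy (\<psi> \<mu>) x (y x)) *v
        (matrix_inv (hess_yy (\<psi> \<mu>) x (y x)) *v grad_y f x (y x))"
proof -
  let ?H = "hess_yy (\<psi> \<mu>) x (y x)" and ?B = "hess_xy (\<psi> \<mu>) x (y x)"
  have I: "y x \<in> int_Y"
    using barrier_solution_interior[OF assms(2)] by (simp add: y_def)
  note H_inv = vector_mult_matrix_inv[OF invertible_hess_yy[OF I assms(2)]]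
  have inv_symmetric: "(matrix_inv ?H *v u) \<bullet> w = u \<bullet> (matrix_inv ?H *v w)" for u w
    using hess_yy_symmetric[OF I, of "matrix_inv ?H *v u" \<mu> x "matrix_inv ?H *v w"] by (simp add: H_inv)
  have f': "((\<lambda>(x, y). f x y) has_derivative (\<lambda>v. v \<bullet> (grad_x f x (y x), grad_y f x (y x)))) (at (x, y x))"
    using GDERIV_gradient[OF f, of "(x, y x)"] gradient_pair[OF f, of x "y x"] by (simp add: gderiv_def)
  have y': "((\<lambda>x. (x, y x)) has_derivative (\<lambda>h. (h, - (matrix_inv ?H *v (?B *v h))))) (at x)"
    using barrier_solution_has_derivative[OF assms(2), of x] unfolding y_def
    by (intro has_derivative_Pair has_derivative_ident)
  have "(barrier_outer_objective A b f g \<mu> has_derivative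
      (\<lambda>h. (h, - (matrix_inv ?H *v (?B *v h))) \<bullet> (grad_x f x (y x), grad_y f x (y x)))) (at x)"
    using has_derivative_compose[OF y', where g = "\<lambda>(x, y). f x y", OF f']
    by (simp add: barrier_outer_objective_def[abs_def] y_def)
  moreover have "(h, - (matrix_inv ?H *v (?B *v h))) \<bullet> (grad_x f x (y x), grad_y f x (y x))
      = h \<bullet> (grad_x f x (y x) - transpose ?B *v (matrix_inv ?H *v grad_y f x (y x)))" for h
  proof -
    have "(matrix_inv ?H *v (?B *v h)) \<bullet> grad_y f x (y x)
        = (?B *v h) \<bullet> (matrix_inv ?H *v grad_y f x (y x))"
      by (rule inv_symmetric)
    also have "\<dots> = h \<bullet> (transpose ?B *v (matrix_inv ?H *v grad_y f x (y x)))"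
      by (metis dot_lmul_matrix inner_commute transpose_matrix_vector)
    finally show ?thesis
      by (simp add: inner_diff_right)
  qed
  ultimately show ?thesis
    by (simp add: gderiv_def)
qed

section \<open>Distance to the constrained solution\<close>

lemma lower_solution_minimizes: "is_arg_min (g x) (\<lambda>y. y \<in> feasible_set A b) (y_opt x)"
proof -
  have "feasible_set A b \<noteq> {}"
    using interior_nonempty interior_subset by blast
  then have "\<exists>y. is_arg_min (g x) (\<lambda>y. y \<in> feasible_set A b) y"
    using continuous_attains_inf[OF compact_feasible _ continuous_g]
    by (simp add: is_arg_min_linorder) blast
  then show ?thesis
    unfolding lower_solution_def arg_min_on_def arg_min_def by (rule someI_ex)
qed

text \<open>
  Stationarity gives \<open>\<nabla>\<^sub>y g = - \<mu> \<nabla>\<phi>\<close> at the barrier solution. The first-order strong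
  convexity inequality of \<open>g x\<close> from there to the constrained minimizer then bounds the gap and
  the squared distance at once.
\<close>

lemma barrier_gap:
  assumes "\<mu> > 0"
  shows "g x (y_opt x) \<le> g x (y\<^sub>\<mu> \<mu> x)"
    and "g x (y\<^sub>\<mu> \<mu> x) - g x (y_opt x) + \<rho> / 2 * (norm (y\<^sub>\<mu> \<mu> x - y_opt x))\<^sup>2 \<le> real CARD('m) * \<mu>"
proof -
  let ?u = "y\<^sub>\<mu> \<mu> x" and ?v = "y_opt x"
  have I: "?u \<in> int_Y"
    using barrier_solution_interior[OF assms] .
  have v: "?v \<in> feasible_set A b" "\<And>z. z \<in> feasible_set A b \<Longrightarrow> g x ?v \<le> g x z"
    using lower_solution_minimizes[of x] by (auto simp: is_arg_min_linorder)
  then show "g x ?v \<le> g x ?u"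
    using I interior_subset by blast
  have "grad_y g x ?u = - (\<mu> *\<^sub>R barrier_gradient A b ?u)"
    using barrier_solution_stationary[OF assms, of x] grad_y_barrier_objective[OF I, of \<mu> x]
    by (simp add: eq_neg_iff_add_eq_0)
  then have "g x ?u - \<mu> * ((?v - ?u) \<bullet> barrier_gradient A b ?u) + \<rho> / 2 * (norm (?v - ?u))\<^sup>2 \<le> g x ?v"
    using strongly_convex_first_order[OF strongly_convex GDERIV_g, of x ?u ?v] by simp
  moreover have "\<mu> * ((?v - ?u) \<bullet> barrier_gradient A b ?u) \<le> \<mu> * real CARD('m)"
    using barrier_gradient_inner_le[OF I v(1)] assms by simp
  ultimately show "g x ?u - g x ?v + \<rho> / 2 * (norm (?u - ?v))\<^sup>2 \<le> real CARD('m) * \<mu>"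
    by (simp add: norm_minus_commute mult.commute)
qed

lemma barrier_solution_error:
  assumes "\<mu> > 0"
  shows "norm (y\<^sub>\<mu> \<mu> x - y_opt x) \<le> sqrt (2 * real CARD('m) / \<rho>) * sqrt \<mu>"
proof -
  have "\<rho> / 2 * (norm (y\<^sub>\<mu> \<mu> x - y_opt x))\<^sup>2 \<le> real CARD('m) * \<mu>"
    using barrier_gap[OF assms, of x] by linarith
  then have "(norm (y\<^sub>\<mu> \<mu> x - y_opt x))\<^sup>2 \<le> 2 * real CARD('m) / \<rho> * \<mu>"
    using rho_pos by (simp add: field_simps)
  then show ?thesis
    by (simp add: real_le_rsqrt flip: real_sqrt_mult)
qed

end

theorem theorem1:
  fixes A :: "real^'k^'m" and b :: "real^'m"
    and f g :: "real^'n \<Rightarrow> real^'k \<Rightarrow> real"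
    and lf0 lf1 lf2 lg0 lg1 lg2 \<rho> :: real
  assumes "compact (feasible_set A b)" and "interior (feasible_set A b) \<noteq> {}"
    and "bdd_below (range (outer_objective A b f g))"
    and A1: "lf1-lipschitz_on UNIV (gradient (\<lambda>(x, y). f x y))"
            "lg1-lipschitz_on UNIV (gradient (\<lambda>(x, y). g x y))"
    and A2: "\<rho> > 0" "\<And>x. strongly_convex \<rho> (g x)"
    and A3: "twice_continuously_differentiable (\<lambda>(x, y). f x y)"
            "twice_continuously_differentiable (\<lambda>(x, y). g x y)"
            "lf2-lipschitz_on UNIV (hessian (\<lambda>(x, y). f x y))"
            "lg2-lipschitz_on UNIV (hessian (\<lambda>(x, y). g x y))"
    and A4: "\<And>x y. norm (grad_x f x y) \<le> lf0"
            "\<And>x y. norm (grad_y f x y) \<le> lf0"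
            "\<And>x y. norm (grad_x g x y) \<le> lg0"
  shows
    "(\<forall>\<mu>>0. \<forall>x.
        (\<exists>!y. is_arg_min (barrier_objective A b g \<mu> x) (\<lambda>y. y \<in> interior (feasible_set A b)) y) \<and>
        barrier_solution A b g \<mu> differentiable (at x) \<and>
        (let y = barrier_solution A b g \<mu> x; \<psi> = barrier_objective A b g \<mu> in
          invertible (hess_yy \<psi> x y) \<and>
          (GDERIV (barrier_outer_objective A b f g \<mu>) x :>
            (grad_x f x y - transpose (hess_xy \<psi> x y) *v
               (matrix_inv (hess_yy \<psi> x y) *v grad_y f x y)))))
     \<and> (\<exists>C\<^sub>g>0. \<exists>C\<^sub>y>0. \<exists>C\<^sub>F>0. \<forall>\<mu>>0. \<forall>x.
        0 \<le> g x (barrier_solution A b g \<mu> x) - g x (lower_solution A b g x) \<and>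
        g x (barrier_solution A b g \<mu> x) - g x (lower_solution A b g x) \<le> C\<^sub>g * \<mu> \<and>
        norm (barrier_solution A b g \<mu> x - lower_solution A b g x) \<le> C\<^sub>y * sqrt \<mu> \<and>
        \<bar>barrier_outer_objective A b f g \<mu> x - outer_objective A b f g x\<bar> \<le> C\<^sub>F * sqrt \<mu>)"
proof -
  interpret barrier_lower_problem A b g \<rho> lg1
    using assms(1,2) A1(2) A2 A3(2)
    by unfold_locales (unfold twice_continuously_differentiable_def, blast+)
  have f_diff: "\<And>z. (\<lambda>(x, y). f x y) differentiable (at z)"
    using A3(1) unfolding twice_continuously_differentiable_def by blast
  define Cy where "Cy = sqrt (2 * real CARD('m) / \<rho>)"
  \<comment> \<open>The hypotheses give only \<open>0 \<le> lf0\<close>; the summand 1 makes the constant strictly positive.\<close>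
  define CF where "CF = (\<bar>lf0\<bar> + 1) * Cy"
  have "Cy > 0"
    using rho_pos by (simp add: Cy_def)
  then have "CF > 0"
    by (simp add: CF_def add_nonneg_pos)
  have outer_error: "\<bar>barrier_outer_objective A b f g \<mu> x - outer_objective A b f g x\<bar> \<le> CF * sqrt \<mu>"
    if "\<mu> > 0" for \<mu> x
  proof -
    have "\<bar>f x (y\<^sub>\<mu> \<mu> x) - f x (y_opt x)\<bar> \<le> (\<bar>lf0\<bar> + 1) * norm (y\<^sub>\<mu> \<mu> x - y_opt x)"
      using A4(2)[of x] by (intro bounded_gradient_lipschitz[OF GDERIV_grad_y[OF f_diff]]) (smt (verit))
    also have "\<dots> \<le> (\<bar>lf0\<bar> + 1) * (Cy * sqrt \<mu>)"
      using barrier_solution_error[OF that, of x] unfolding Cy_def by (intro mult_left_mono) auto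
    finally show ?thesis
      by (simp add: barrier_outer_objective_def outer_objective_def CF_def mult.assoc)
  qed
  have gap: "g x (y\<^sub>\<mu> \<mu> x) - g x (y_opt x) \<le> real CARD('m) * \<mu>" if "\<mu> > 0" for \<mu> x
  proof -
    have "0 \<le> \<rho> / 2 * (norm (y\<^sub>\<mu> \<mu> x - y_opt x))\<^sup>2"
      using rho_pos by simp
    then show ?thesis
      using barrier_gap(2)[OF that, of x] by linarith
  qed
  show ?thesis
  proof (rule conjI)
    show "\<forall>\<mu>>0. \<forall>x.
        (\<exists>!y. is_arg_min (\<psi> \<mu> x) (\<lambda>y. y \<in> int_Y) y) \<and>
        y\<^sub>\<mu> \<mu> differentiable (at x) \<and>
        (let y = y\<^sub>\<mu> \<mu> x; \<psi> = \<psi> \<mu> in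
          invertible (hess_yy \<psi> x y) \<and>
          (GDERIV (barrier_outer_objective A b f g \<mu>) x :>
            (grad_x f x y - transpose (hess_xy \<psi> x y) *v
               (matrix_inv (hess_yy \<psi> x y) *v grad_y f x y))))"
      unfolding Let_def
      using ex1_barrier_minimizer barrier_solution_has_derivative[THEN differentiableI]
        invertible_hess_yy[OF barrier_solution_interior] GDERIV_barrier_outer_objective[OF f_diff]
      by blast
    show "\<exists>Cg>0. \<exists>Cy>0. \<exists>CF>0. \<forall>\<mu>>0. \<forall>x.
        0 \<le> g x (y\<^sub>\<mu> \<mu> x) - g x (y_opt x) \<and>
        g x (y\<^sub>\<mu> \<mu> x) - g x (y_opt x) \<le> Cg * \<mu> \<and>
        norm (y\<^sub>\<mu> \<mu> x - y_opt x) \<le> Cy * sqrt \<mu> \<and>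
        \<bar>barrier_outer_objective A b f g \<mu> x - outer_objective A b f g x\<bar> \<le> CF * sqrt \<mu>"
    proof (rule exI[of _ "real CARD('m)"], rule conjI, simp,
        rule exI[of _ Cy], rule conjI[OF \<open>Cy > 0\<close>],
        rule exI[of _ CF], rule conjI[OF \<open>CF > 0\<close>], intro allI impI conjI)
      fix \<mu> :: real and x assume "\<mu> > 0"
      then show "0 \<le> g x (y\<^sub>\<mu> \<mu> x) - g x (y_opt x)"
        "g x (y\<^sub>\<mu> \<mu> x) - g x (y_opt x) \<le> real CARD('m) * \<mu>"
        "norm (y\<^sub>\<mu> \<mu> x - y_opt x) \<le> Cy * sqrt \<mu>"
        "\<bar>barrier_outer_objective A b f g \<mu> x - outer_objective A b f g x\<bar> \<le> CF * sqrt \<mu>"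
        using barrier_gap(1)[of \<mu> x] gap barrier_solution_error outer_error
        by (simp_all add: Cy_def)
    qed
  qed
qed

end
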